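(* Let $\Gamma\in\mathcal L(\mathbb R^3,\mathbb C^{3\times3})$ be a ($\mathbb R$-)linear map, valued in the set of self-adjoint matrices, such that for all $(\sigma,z,\zeta)\in\mathbb R^3$ the eigenvalues of $\Gamma(\sigma,z,\zeta)$ are $$-\sqrt{\sigma^2+z^2+\zeta^2},\quad 0,\quad \sqrt{\sigma^2+z^2+\zeta^2}.$$ Then there exist $\delta\in\{-1,+1\}$, a unitary matrix $U\in\mathbb C^{3\times3}$ and a linear symplectic change of variables $\kappa$ on $\mathbb R^2=T^*\mathbb R$ such that, for all $(\sigma,z,\zeta)\in\mathbb R^3$, $$U\,\Gamma(\sigma,\kappa(z,\zeta))\,U^*=\Gamma_\bullet(\sigma,z,\delta\zeta),$$ where $\Gamma_\bullet$ is one of the matrices $\Gamma_{\rm JT}$, $\Gamma_{\rm PJT}$, or $\Gamma_{\alpha,\gamma}$ for some real $\alpha,\gamma$ with $\alpha\ge0$ and $\gamma^2+2\alpha^2=1$, defined in the context.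
   Context: The model matrices are, for $(\sigma,z,\zeta)\in\mathbb R^3$, $$\Gamma_{\rm JT}(\sigma,z,\zeta)=\begin{pmatrix}\sigma & z-i\zeta & 0\\ z+i\zeta & -\sigma & 0\\ 0&0&0\end{pmatrix},$$ $$\Gamma_{\rm PJT}(\sigma,z,\zeta)=\begin{pmatrix}\sigma & 0 & \frac1{\sqrt2}(z-i\zeta)\\ 0&-\sigma&\frac1{\sqrt2}(z+i\zeta)\\ \frac1{\sqrt2}(z+i\zeta)&\frac1{\sqrt2}(z-i\zeta)&0\end{pmatrix},$$ $$\Gamma_{\alpha,\gamma}(\sigma,z,\zeta)=\begin{pmatrix}\sigma & i\gamma z & \alpha z+\frac i{\sqrt2}\zeta\\ -i\gamma z&-\sigma&\alpha z+\frac i{\sqrt2}\zeta\\ \alpha z-\frac i{\sqrt2}\zeta&\alpha z-\frac i{\sqrt2}\zeta&0\end{pmatrix},\qquad \alpha\ge0,\ \gamma\in\mathbb R,\ \gamma^2+2\alpha^2=1.$$ A linear symplectic change of variables on $\mathbb R^2=T^*\mathbb R$ is a linear map $\kappa:\mathbb R^2\to\mathbb R^2$ of determinant $1$. *)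

theory Defs
  imports "HOL-Analysis.Analysis"
begin

definition ctranspose :: "complex^'n^'m \<Rightarrow> complex^'m^'n"
  where "ctranspose A = (\<chi> i j. cnj (A $ j $ i))"

definition self_adjoint_mat :: "complex^'n^'n \<Rightarrow> bool"
  where "self_adjoint_mat A \<longleftrightarrow> ctranspose A = A"

definition unitary_mat :: "complex^'n^'n \<Rightarrow> bool"
  where "unitary_mat U \<longleftrightarrow> U ** ctranspose U = mat 1 \<and> ctranspose U ** U = mat 1"

(* A set, without multiplicities: a 3x3 matrix with spectrum {-r, 0, r} has simple eigenvalues
   if r > 0 and the eigenvalue 0 only if r = 0. *)
definition eigenvalues :: "complex^'n^'n \<Rightarrow> complex set"
  where "eigenvalues A = {\<mu>. \<exists>v. v \<noteq> 0 \<and> A *v v = \<mu> *s v}"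

definition linear_symplectic2 :: "(real^2 \<Rightarrow> real^2) \<Rightarrow> bool"
  where "linear_symplectic2 \<kappa> \<longleftrightarrow> linear \<kappa> \<and> det (matrix \<kappa>) = 1"

definition Gamma_JT :: "real \<Rightarrow> real \<Rightarrow> real \<Rightarrow> complex^3^3"
  where "Gamma_JT \<sigma> z \<zeta> = vector
    [vector [of_real \<sigma>, of_real z - \<i> * of_real \<zeta>, 0],
     vector [of_real z + \<i> * of_real \<zeta>, - of_real \<sigma>, 0],
     vector [0, 0, 0]]"

definition Gamma_PJT :: "real \<Rightarrow> real \<Rightarrow> real \<Rightarrow> complex^3^3"
  where "Gamma_PJT \<sigma> z \<zeta> =
    (let w = of_real (1 / sqrt 2) * (of_real z + \<i> * of_real \<zeta>);
         w' = of_real (1 / sqrt 2) * (of_real z - \<i> * of_real \<zeta>)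
     in vector
       [vector [of_real \<sigma>, 0, w'],
        vector [0, - of_real \<sigma>, w],
        vector [w, w', 0]])"

definition Gamma_mixed :: "real \<Rightarrow> real \<Rightarrow> real \<Rightarrow> real \<Rightarrow> real \<Rightarrow> complex^3^3"
  where "Gamma_mixed \<alpha> \<gamma> \<sigma> z \<zeta> =
    (let w = of_real (\<alpha> * z) + \<i> * of_real (\<zeta> / sqrt 2);
         w' = of_real (\<alpha> * z) - \<i> * of_real (\<zeta> / sqrt 2)
     in vector
       [vector [of_real \<sigma>, \<i> * of_real (\<gamma> * z), w],
        vector [- (\<i> * of_real (\<gamma> * z)), - of_real \<sigma>, w],
        vector [w', w', 0]])"

end

theory Submission
  imports Defs
begin

text \<open>
  Conjugating by a unitary, one may assume that the matrix at (1,0,0) is diag(1,-1,0). The spectrum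
  prescribes the characteristic polynomial, and comparing its coefficients as polynomials in
  \<open>\<sigma>\<close> forces all other diagonal entries to vanish; the entries a, b, c above the diagonal are
  real-linear in \<open>(z, \<zeta>)\<close> with |b| = |c|, |a|^2 + 2|b|^2 = z^2 + \<open>\<zeta>\<close>^2 and Re(a c cnj b) = 0.
  Equality of moduli leaves two options: c = u b or c = u cnj b for a phase u. If b = 0, then a is
  an isometry (JT). If c = u b, then u a is imaginary, and a rotation of the plane makes it vanish
  on the second axis (mixed case). If c = u cnj b with b of rank 2, then Re(u a (cnj b)^2) = 0
  forces a = 0 (PJT). Diagonal unitaries and the sign \<open>\<delta>\<close> then normalise the phases.
\<close>

section \<open>Conjugation by diagonal and unitary matrices\<close>

definition diag_mat :: "complex^'n \<Rightarrow> complex^'n^'n"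
  where "diag_mat u = (\<chi> i j. if i = j then u $ i else 0)"

lemma diag_mat_conjugate:
  "(diag_mat u ** A ** ctranspose (diag_mat u)) $ i $ j = u $ i * A $ i $ j * cnj (u $ j)"
proof -
  have left: "(diag_mat u ** B) $ i $ j = u $ i * B $ i $ j" for B
    by (simp add: matrix_matrix_mult_def diag_mat_def if_distrib[of "\<lambda>x. x * _"] cong: if_cong)
  have "(A ** ctranspose (diag_mat u)) $ i $ j = (\<Sum>k\<in>UNIV. if j = k then A $ i $ k * cnj (u $ k) else 0)"
    unfolding matrix_matrix_mult_def ctranspose_def diag_mat_def vec_lambda_beta
    by (rule sum.cong) auto
  then show ?thesis
    by (simp add: left flip: matrix_mul_assoc)
qed

lemma ctranspose_matrix_mult: "ctranspose (A ** B) = ctranspose B ** ctranspose A"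
  by (simp add: vec_eq_iff ctranspose_def matrix_matrix_mult_def mult.commute)

lemma ctranspose_ctranspose [simp]: "ctranspose (ctranspose A) = A"
  by (simp add: vec_eq_iff ctranspose_def)

lemma unitary_matI: "U ** ctranspose U = mat 1 \<Longrightarrow> unitary_mat U"
  by (simp add: unitary_mat_def matrix_left_right_inverse)

lemma unitary_mat_mult:
  assumes "unitary_mat U" "unitary_mat V"
  shows "unitary_mat (U ** V)"
proof (rule unitary_matI)
  have "(U ** V) ** ctranspose (U ** V) = U ** (V ** ctranspose V) ** ctranspose U"
    by (simp add: ctranspose_matrix_mult matrix_mul_assoc)
  then show "(U ** V) ** ctranspose (U ** V) = mat 1"
    using assms by (simp add: unitary_mat_def)
qed

lemma unitary_diag_mat:
  assumes "\<And>i. cmod (u $ i) = 1"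
  shows "unitary_mat (diag_mat u)"
proof (rule unitary_matI)
  have "diag_mat u ** ctranspose (diag_mat u) = diag_mat u ** mat 1 ** ctranspose (diag_mat u)"
    by simp
  also have "\<dots> = mat 1"
    using assms by (simp add: vec_eq_iff diag_mat_conjugate mat_def flip: complex_norm_square)
  finally show "diag_mat u ** ctranspose (diag_mat u) = mat 1" .
qed

lemma self_adjoint_conjugate:
  assumes "self_adjoint_mat A"
  shows "self_adjoint_mat (U ** A ** ctranspose U)"
  using assms by (simp add: self_adjoint_mat_def ctranspose_matrix_mult matrix_mul_assoc)

lemma eigenvalues_conjugate_subset:
  assumes "unitary_mat U"
  shows "eigenvalues A \<subseteq> eigenvalues (U ** A ** ctranspose U)"
proof
  fix \<mu> assume "\<mu> \<in> eigenvalues A"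
  then obtain v where v: "v \<noteq> 0" "A *v v = \<mu> *s v"
    by (auto simp: eigenvalues_def)
  have inv: "ctranspose U *v (U *v v) = v"
    using assms by (simp add: matrix_vector_mul_assoc unitary_mat_def)
  then have "U *v v \<noteq> 0"
    using v(1) by (metis matrix_vector_mult_0_right)
  moreover have "(U ** A ** ctranspose U) *v (U *v v) = \<mu> *s (U *v v)"
    using inv v(2) by (simp add: vector_scalar_commute flip: matrix_vector_mul_assoc)
  ultimately show "\<mu> \<in> eigenvalues (U ** A ** ctranspose U)"
    by (auto simp: eigenvalues_def)
qed

section \<open>Diagonalisation and the characteristic polynomial\<close>

lemma eigenvalue_det_eq_0:
  fixes A :: "complex^'n^'n"
  assumes "\<mu> \<in> eigenvalues A"
  shows "det (A - mat \<mu>) = 0"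
proof -
  obtain v where v: "v \<noteq> 0" "A *v v = \<mu> *s v"
    using assms by (auto simp: eigenvalues_def)
  have "mat \<mu> *v v = \<mu> *s v"
    by (simp add: vec_eq_iff mat_def matrix_vector_mult_def if_distrib[of "\<lambda>x. x * _"] cong: if_cong)
  then have "(A - mat \<mu>) *v v = 0"
    using v(2) by (simp add: matrix_vector_mult_diff_rdistrib)
  then have "\<not> invertible (A - mat \<mu>)"
    using v(1) matrix_left_invertible_ker invertible_def by metis
  then show ?thesis
    by (simp add: invertible_det_nz)
qed

text \<open>Eigenvectors of a self-adjoint matrix for distinct real eigenvalues are orthogonal. As
  \<open>l\<close> is injective on the index type itself, there are as many of them as the
  dimension, and normalising gives an orthonormal basis.\<close>

lemma unitary_diagonalisation:
  fixes A :: "complex^'n^'n" and l :: "'n \<Rightarrow> real"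
  assumes sa: "self_adjoint_mat A" and "inj l"
    and ev: "\<And>i. of_real (l i) \<in> eigenvalues A"
  obtains U where "unitary_mat U" "U ** A ** ctranspose U = diag_mat (\<chi> i. of_real (l i))"
proof -
  \<comment> \<open>The Hermitian product, conjugate-linear in its first argument; the inner product
    of the type is only its real part.\<close>
  define h :: "complex^'n \<Rightarrow> complex^'n \<Rightarrow> complex"
    where "h x y = (\<Sum>k\<in>UNIV. cnj (x $ k) * y $ k)" for x y
  have h_self: "h x x = of_real ((norm x)\<^sup>2)" for x
    by (simp add: h_def norm_vec_def L2_set_def sum_nonneg complex_norm_square mult.commute
        del: of_real_power)
  have h_adj: "h x (A *v y) = h (A *v x) y" for x y
  proof -
    have A_cnj: "cnj (A $ i $ j) = A $ j $ i" for i j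
      using sa by (auto simp: self_adjoint_mat_def ctranspose_def vec_eq_iff)
    have "h x (A *v y) = (\<Sum>i\<in>UNIV. \<Sum>j\<in>UNIV. cnj (x $ i) * A $ i $ j * y $ j)"
      by (simp add: h_def matrix_vector_mult_def sum_distrib_left mult.assoc)
    also have "\<dots> = (\<Sum>j\<in>UNIV. \<Sum>i\<in>UNIV. cnj (x $ i) * A $ i $ j * y $ j)"
      by (rule sum.swap)
    also have "\<dots> = h (A *v x) y"
      by (simp add: h_def matrix_vector_mult_def sum_distrib_left sum_distrib_right A_cnj mult_ac)
    finally show ?thesis .
  qed
  have h_scale: "h (c *s x) y = cnj c * h x y" "h x (c *s y) = c * h x y" for c x y
    by (simp_all add: h_def sum_distrib_left algebra_simps)
  obtain v where v: "\<And>i. v i \<noteq> 0" "\<And>i. A *v v i = of_real (l i) *s v i"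
    using ev unfolding eigenvalues_def mem_Collect_eq by metis
  define w where "w i = complex_of_real (1 / norm (v i)) *s v i" for i
  have Aw: "A *v w i = of_real (l i) *s w i" for i
    by (simp add: w_def vector_scalar_commute v(2) vector_smult_assoc mult.commute)
  have orth: "h (w i) (w j) = (if i = j then 1 else 0)" for i j
  proof (cases "i = j")
    case True
    have "norm (v j) \<noteq> 0" using v(1) by simp
    then show ?thesis
      unfolding True w_def by (simp only: h_scale) (simp add: h_self power2_eq_square)
  next
    case False
    \<comment> \<open>Both sides evaluate \<open>h (w i) (A *v w j)\<close>; conjugation leaves the
      real number \<open>l i\<close> unchanged.\<close>
    have "of_real (l j) * h (w i) (w j) = of_real (l i) * h (w i) (w j)"
      using h_adj[of "w i" "w j"] by (simp add: Aw h_scale)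
    then show ?thesis
      using False \<open>inj l\<close> by (auto simp: inj_eq)
  qed
  \<comment> \<open>Rows are conjugated eigenvectors, so the columns of \<open>ctranspose U\<close>
    are the eigenvectors themselves.\<close>
  define U where "U = (\<chi> i k. cnj (w i $ k))"
  have UU: "U ** ctranspose U = mat 1"
    using orth by (simp add: vec_eq_iff U_def ctranspose_def matrix_matrix_mult_def mat_def h_def)
  have "(A ** ctranspose U) $ k $ i = (ctranspose U ** diag_mat (\<chi> i. of_real (l i))) $ k $ i" for k i
  proof -
    have "(A ** ctranspose U) $ k $ i = (A *v w i) $ k"
      by (simp add: matrix_matrix_mult_def matrix_vector_mult_def U_def ctranspose_def)
    also have "\<dots> = (ctranspose U ** diag_mat (\<chi> i. of_real (l i))) $ k $ i"
      by (simp add: Aw matrix_matrix_mult_def U_def ctranspose_def diag_mat_def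
          if_distrib cong: if_cong)
    finally show ?thesis .
  qed
  then have "A ** ctranspose U = ctranspose U ** diag_mat (\<chi> i. of_real (l i))"
    by (simp add: vec_eq_iff)
  then have "U ** A ** ctranspose U = diag_mat (\<chi> i. of_real (l i))"
    by (metis UU matrix_mul_assoc matrix_mul_lid)
  with UU unitary_matI that show thesis by blast
qed

text \<open>For nonzero \<open>r\<close> the three eigenvalues are distinct, so they are all the
  roots of the characteristic cubic and fix its coefficients.\<close>

lemma charpoly_coeffs_3:
  fixes A :: "complex^3^3" and r :: real
  assumes ev: "{complex_of_real (- r), 0, complex_of_real r} \<subseteq> eigenvalues A" and r: "r \<noteq> 0"
  shows "A$1$1 + A$2$2 + A$3$3 = 0"
    and "A$1$1 * A$2$2 + A$1$1 * A$3$3 + A$2$2 * A$3$3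
         - A$1$2 * A$2$1 - A$1$3 * A$3$1 - A$2$3 * A$3$2 = - complex_of_real (r\<^sup>2)"
    and "det A = 0"
proof -
  define e1 where "e1 = A$1$1 + A$2$2 + A$3$3"
  define e2 where "e2 = A$1$1 * A$2$2 + A$1$1 * A$3$3 + A$2$2 * A$3$3
         - A$1$2 * A$2$1 - A$1$3 * A$3$1 - A$2$3 * A$3$2"
  define R where "R = complex_of_real r"
  have cp: "det (A - mat \<mu>) = - (\<mu> ^ 3) + e1 * \<mu> ^ 2 - e2 * \<mu> + det A" for \<mu>
    unfolding det_3 e1_def e2_def
    by (simp add: mat_def algebra_simps power2_eq_square power3_eq_cube)
  have R0: "R \<noteq> 0" using r by (simp add: R_def)
  have D0: "det A = 0"
    using eigenvalue_det_eq_0[of 0 A] cp[of 0] ev by simp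
  have p: "- (R^3) + e1 * R^2 - e2 * R = 0"
    using eigenvalue_det_eq_0[of R A] cp[of R] ev D0 by (simp add: R_def)
  have m: "R^3 + e1 * R^2 + e2 * R = 0"
    using eigenvalue_det_eq_0[of "-R" A] cp[of "-R"] ev D0 by (simp add: R_def)
  have "2 * R^2 * e1 = 0" using p m by algebra
  then have E1: "e1 = 0" using R0 by simp
  have "R * (e2 + R^2) = 0" using m E1 by algebra
  then have E2: "e2 = - (R^2)" using R0 by (simp add: eq_neg_iff_add_eq_0)
  show "A$1$1 + A$2$2 + A$3$3 = 0" using E1 e1_def by simp
  show "A$1$1 * A$2$2 + A$1$1 * A$3$3 + A$2$2 * A$3$3
         - A$1$2 * A$2$1 - A$1$3 * A$3$1 - A$2$3 * A$3$2 = - complex_of_real (r\<^sup>2)"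
    using E2 by (simp add: e2_def R_def)
  show "det A = 0" by (rule D0)
qed

section \<open>Real-linear entries and the common shape of the models\<close>

definition rlin :: "complex \<Rightarrow> complex \<Rightarrow> real \<Rightarrow> real \<Rightarrow> complex"
  where "rlin x y z w = of_real z * x + of_real w * y"

text \<open>The shape shared by all three model families, so that comparing matrices reduces to
  comparing three entries.\<close>

definition herm :: "real \<Rightarrow> complex \<Rightarrow> complex \<Rightarrow> complex \<Rightarrow> complex^3^3"
  where "herm \<sigma> a b c = vector
    [vector [of_real \<sigma>, a, b], vector [cnj a, - of_real \<sigma>, c], vector [cnj b, cnj c, 0]]"

lemma mult_cnj_eq_1: "cmod u = 1 \<Longrightarrow> u * cnj u = 1"
  by (simp flip: complex_norm_square)

text \<open>The diagonal is invariant. Of the three phases acting on \<open>a\<close>,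
  \<open>b\<close>, \<open>c\<close>, the one on \<open>b\<close> is the product of the other two,
  so only two can be prescribed.\<close>

lemma diag_mat_conjugate_herm:
  assumes "\<And>i. cmod (u $ i) = 1"
  shows "diag_mat u ** herm \<sigma> a b c ** ctranspose (diag_mat u) =
    herm \<sigma> (u$1 * cnj (u$2) * a) (u$1 * cnj (u$3) * b) (u$2 * cnj (u$3) * c)"
proof -
  have *: "u $ i * (y * cnj (u $ i)) = y" for i y
    using assms[of i] complex_norm_square[of "u $ i"] by (simp add: mult.left_commute)
  have "u $ i * cnj (u $ i) = 1" for i
    using *[of i 1] by simp
  with * show ?thesis
    by (simp add: vec_eq_iff forall_3 diag_mat_conjugate herm_def algebra_simps)
qed

lemma Gamma_eq_herm:
  "Gamma_JT \<sigma> z \<zeta> = herm \<sigma> (rlin 1 (- \<i>) z \<zeta>) 0 0"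
  "Gamma_PJT \<sigma> z \<zeta> = herm \<sigma> 0 (rlin (of_real (1 / sqrt 2)) (- \<i> * of_real (1 / sqrt 2)) z \<zeta>)
     (rlin (of_real (1 / sqrt 2)) (\<i> * of_real (1 / sqrt 2)) z \<zeta>)"
  "Gamma_mixed \<alpha> \<gamma> \<sigma> z \<zeta> = herm \<sigma> (rlin (\<i> * of_real \<gamma>) 0 z \<zeta>)
     (rlin (of_real \<alpha>) (\<i> * of_real (1 / sqrt 2)) z \<zeta>) (rlin (of_real \<alpha>) (\<i> * of_real (1 / sqrt 2)) z \<zeta>)"
  by (simp_all add: Gamma_JT_def Gamma_PJT_def Gamma_mixed_def Let_def herm_def rlin_def
      vec_eq_iff forall_3 algebra_simps add_divide_distrib diff_divide_distrib)

lemma rlin_rotate: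
  "rlin x y (k * z - l * w) (l * z + k * w) =
   rlin (of_real k * x + of_real l * y) (of_real k * y - of_real l * x) z w"
  by (simp add: rlin_def algebra_simps)

lemma rlin_mult: "c * rlin x y z w = rlin (c * x) (c * y) z w"
  by (simp add: rlin_def algebra_simps)

lemma rlin_scale_right: "rlin x y z (d * w) = rlin x (of_real d * y) z w"
  by (simp add: rlin_def)

lemma cmod_rlin_power2:
  "(cmod (rlin x y z w))\<^sup>2 = z\<^sup>2 * (cmod x)\<^sup>2 + w\<^sup>2 * (cmod y)\<^sup>2 + 2 * z * w * Re (x * cnj y)"
  unfolding rlin_def cmod_power2 by (simp add: algebra_simps power2_eq_square)

text \<open>A phase turns \<open>x\<close> onto the nonnegative real axis; the orthogonal vector
  \<open>y\<close> then lies on the imaginary axis, on a side recorded by \<open>d\<close>. This is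
  the source of the sign \<delta> in the theorem.\<close>

lemma orthogonal_phase:
  assumes orth: "Re (x * cnj y) = 0" and y: "y \<noteq> 0"
  obtains v and d :: real where "cmod v = 1" "d \<in> {-1, 1}" "v * x = of_real (cmod x)"
    "v * y = \<i> * of_real (d * cmod y)"
proof (cases "x = 0")
  case True
  show thesis
  proof (rule that)
    \<comment> \<open>With \<open>x = 0\<close> the phase is free to be adapted to \<open>y\<close>,
      giving \<open>d = 1\<close>.\<close>
    show "cmod (\<i> * cnj y / of_real (cmod y)) = 1"
      using y by (simp add: norm_mult norm_divide)
    show "\<i> * cnj y / of_real (cmod y) * y = \<i> * of_real (1 * cmod y)"
      using y complex_norm_square[of y] by (simp add: field_simps power2_eq_square)
  qed (use True in auto)
next
  case False
  define v where "v = cnj x / of_real (cmod x)"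
  have v: "cmod v = 1" using False by (simp add: v_def norm_divide)
  have vx: "v * x = of_real (cmod x)"
    using False complex_norm_square[of x] by (simp add: v_def field_simps power2_eq_square)
  have "Re (v * y) = 0"
    using orth by (simp add: v_def algebra_simps)
  then have vy: "v * y = \<i> * of_real (Im (v * y))"
    by (simp add: complex_eq_iff)
  then have "\<bar>Im (v * y)\<bar> = cmod y"
    by (metis mult_1 norm_ii norm_mult norm_of_real v)
  then obtain d :: real where "d \<in> {-1, 1}" "Im (v * y) = d * cmod y"
    by (cases "Im (v * y) \<ge> 0") (force+)
  with v vx vy that show thesis by metis
qed

text \<open>Equal moduli force \<open>c1 * cnj c2\<close> and \<open>b1 * cnj b2\<close> to share
  modulus and real part, so they are equal or conjugate. If the imaginary part vanishes the two
  options coincide and are counted as linear; the antilinear case thus has \<open>b\<close> of rank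
  2.\<close>

lemma rlin_eq_modulus:
  assumes eq: "\<And>z w. cmod (rlin c1 c2 z w) = cmod (rlin b1 b2 z w)"
  obtains (linear) u where "cmod u = 1" "c1 = u * b1" "c2 = u * b2"
  | (antilinear) u where "cmod u = 1" "c1 = u * cnj b1" "c2 = u * cnj b2" "Im (b1 * cnj b2) \<noteq> 0"
proof -
  have n1: "cmod c1 = cmod b1" using eq[of 1 0] by (simp add: rlin_def)
  have n2: "cmod c2 = cmod b2" using eq[of 0 1] by (simp add: rlin_def)
  have re: "Re (c1 * cnj c2) = Re (b1 * cnj b2)"
    using cmod_rlin_power2[of c1 c2 1 1] cmod_rlin_power2[of b1 b2 1 1] eq[of 1 1] n1 n2 by simp
  show thesis
  proof (cases "b1 = 0")
    case b1: True
    show thesis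
    proof (cases "b2 = 0")
      case True
      then show thesis using linear[of 1] b1 n1 n2 by simp
    next
      case False
      then show thesis using linear[of "c2 / b2"] b1 n1 n2 by (simp add: norm_divide)
    qed
  next
    case False
    with n1 have nz: "c1 \<noteq> 0" "b1 \<noteq> 0" by auto
    have sq: "c1 * cnj c1 = b1 * cnj b1"
      using n1 by (metis complex_norm_square)
    have "(cmod (c1 * cnj c2))\<^sup>2 = (cmod (b1 * cnj b2))\<^sup>2"
      by (simp add: norm_mult n1 n2)
    then have "(Im (c1 * cnj c2))\<^sup>2 = (Im (b1 * cnj b2))\<^sup>2"
      unfolding cmod_power2 re by simp
    then consider "c1 * cnj c2 = b1 * cnj b2"
      | "c1 * cnj c2 = cnj (b1 * cnj b2)" "Im (b1 * cnj b2) \<noteq> 0"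
      using re unfolding power2_eq_iff complex_eq_iff
      by (metis cnj.sel(1) cnj.sel(2) minus_zero)
    then show thesis
    proof cases
      case 1
      then have "cnj c1 * c2 = cnj b1 * b2"
        by (metis complex_cnj_cnj complex_cnj_mult)
      \<comment> \<open>Multiplying by the nonzero number \<open>c1 * cnj c1 = b1 * cnj b1\<close>
        removes the conjugates; it is then cancelled.\<close>
      with sq have "c1 * cnj c1 * (c2 * b1) = c1 * cnj c1 * (c1 * b2)"
        by algebra
      then have "c2 * b1 = c1 * b2" using nz by simp
      then show thesis
        using linear[of "c1 / b1"] nz n1 by (simp add: norm_divide field_simps)
    next
      case 2
      then have "cnj c1 * c2 = b1 * cnj b2"
        by (metis complex_cnj_cnj complex_cnj_mult)
      with sq have "c1 * cnj c1 * (c2 * cnj b1) = c1 * cnj c1 * (c1 * cnj b2)"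
        by algebra
      then have "c2 * cnj b1 = c1 * cnj b2" using nz by simp
      then show thesis
        using antilinear[of "c1 / cnj b1"] nz n1 2(2) by (simp add: norm_divide field_simps)
    qed
  qed
qed

text \<open>Cramer's rule: multiplying by \<open>cnj y\<close> and taking imaginary parts eliminates
  the \<open>y\<close> term, and likewise for \<open>x\<close>.\<close>

lemma rlin_surj:
  assumes "Im (x * cnj y) \<noteq> 0"
  obtains z w where "rlin x y z w = t"
proof
  show "rlin x y (Im (t * cnj y) / Im (x * cnj y)) (- Im (t * cnj x) / Im (x * cnj y)) = t"
    using assms by (simp add: rlin_def complex_eq_iff divide_simps) (simp add: algebra_simps)
qed

text \<open>Since b is bijective, it can be used as the coordinate; the values 1, \<open>\<i>\<close>, 1 + \<open>\<i>\<close>, 1 - \<open>\<i>\<close> suffice.\<close>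

lemma rlin_eq_0_if_cubic_eq_0:
  assumes D: "Im (b1 * cnj b2) \<noteq> 0"
    and re: "\<And>z w. Re (rlin a1 a2 z w * (cnj (rlin b1 b2 z w))\<^sup>2) = 0"
  shows "a1 = 0" "a2 = 0"
proof -
  obtain z w where 1: "rlin b1 b2 z w = 1" using rlin_surj[OF D] .
  obtain z' w' where i: "rlin b1 b2 z' w' = \<i>" using rlin_surj[OF D] .
  have add: "rlin x y (z + z') (w + w') = rlin x y z w + rlin x y z' w'"
    and diff: "rlin x y (z - z') (w - w') = rlin x y z w - rlin x y z' w'" for x y
    by (simp_all add: rlin_def algebra_simps)
  \<comment> \<open>Where \<open>b\<close> is 1 or \<i>, the square of its conjugate is real and the
    hypothesis sees real parts; at 1 + \<i> and 1 - \<i> the square is imaginary and it sees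
    imaginary parts.\<close>
  have "Re (rlin a1 a2 z w) = 0" using re[of z w] 1 by simp
  moreover have "Re (rlin a1 a2 z' w') = 0" using re[of z' w'] i by simp
  moreover have "Im (rlin a1 a2 z w) + Im (rlin a1 a2 z' w') = 0"
    using re[of "z + z'" "w + w'"] by (simp add: add 1 i power2_eq_square)
  moreover have "Im (rlin a1 a2 z w) - Im (rlin a1 a2 z' w') = 0"
    using re[of "z - z'" "w - w'"] by (simp add: diff 1 i power2_eq_square)
  ultimately have a: "rlin a1 a2 z w = 0" "rlin a1 a2 z' w' = 0"
    by (simp_all add: complex_eq_iff)
  \<comment> \<open>The points where \<open>b\<close> is 1 and \<i> are linearly independent, so
    \<open>a\<close>, vanishing at both, vanishes identically.\<close>
  have det: "z * w' - z' * w \<noteq> 0"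
  proof
    assume *: "z * w' - z' * w = 0"
    have "of_real w' * rlin b1 b2 z w - of_real w * rlin b1 b2 z' w' = of_real (z * w' - z' * w) * b1"
      by (simp add: rlin_def algebra_simps)
    then have "w = 0" "w' = 0" unfolding 1 i * by (auto simp: complex_eq_iff)
    then have "of_real z * b1 = 1" "of_real z' * b1 = \<i>" using 1 i by (simp_all add: rlin_def)
    moreover have "of_real z' * (of_real z * b1) = of_real z * (of_real z' * b1)" by simp
    ultimately have "of_real z' = of_real z * \<i>" by simp
    then have "z = 0" by (simp add: complex_eq_iff)
    with \<open>of_real z * b1 = 1\<close> show False by simp
  qed
  have "of_real (z * w' - z' * w) * a1 = of_real w' * rlin a1 a2 z w - of_real w * rlin a1 a2 z' w'"
    by (simp add: rlin_def algebra_simps)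
  then show "a1 = 0" using a det by (metis diff_zero mult_eq_0_iff mult_zero_right of_real_eq_0_iff)
  have "of_real (z * w' - z' * w) * a2 = of_real z * rlin a1 a2 z' w' - of_real z' * rlin a1 a2 z w"
    by (simp add: rlin_def algebra_simps)
  then show "a2 = 0" using a det by (metis diff_zero mult_eq_0_iff mult_zero_right of_real_eq_0_iff)
qed

section \<open>Constraints on the entries imposed by the spectrum\<close>

text \<open>With \<open>B\<close> fixed, each coefficient of the characteristic polynomial is a
  polynomial in \<open>x\<close> known for all nonzero \<open>x\<close>, so its own coefficients in
  \<open>x\<close> can be compared.\<close>

lemma spectral_conditions:
  fixes B :: "complex^3^3" and m :: real
  assumes sa: "self_adjoint_mat B" and m: "m \<ge> 0"
    and ev: "\<And>x::real. {complex_of_real (- sqrt (x\<^sup>2 + m)), 0, complex_of_real (sqrt (x\<^sup>2 + m))}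
      \<subseteq> eigenvalues (herm x 0 0 0 + B)"
  shows "B = herm 0 (B$1$2) (B$1$3) (B$2$3)"
    and "(cmod (B$1$2))\<^sup>2 + 2 * (cmod (B$1$3))\<^sup>2 = m"
    and "cmod (B$2$3) = cmod (B$1$3)"
    and "Re (B$1$2 * B$2$3 * cnj (B$1$3)) = 0"
proof -
  define a b c where "a = B$1$2" and "b = B$1$3" and "c = B$2$3"
  define p q s where "p = Re (B$1$1)" and "q = Re (B$2$2)" and "s = Re (B$3$3)"
  define A B' C where "A = (cmod a)\<^sup>2" and "B' = (cmod b)\<^sup>2" and "C = (cmod c)\<^sup>2"
  define T where "T = Re (a * c * cnj b)"
  have cnj_B: "B $ j $ i = cnj (B $ i $ j)" for i j
    using sa by (auto simp: self_adjoint_mat_def ctranspose_def vec_eq_iff)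
  have B21: "B$2$1 = cnj a" "B$3$1 = cnj b" "B$3$2 = cnj c"
    unfolding a_def b_def c_def by (rule cnj_B)+
  have "Im (B$i$i) = 0" for i
    using cnj_B[of i i] by (simp add: complex_eq_iff)
  then have Bii: "B$1$1 = of_real p" "B$2$2 = of_real q" "B$3$3 = of_real s"
    by (simp_all add: p_def q_def s_def complex_eq_iff)
  \<comment> \<open>Requiring \<open>x\<close> nonzero keeps the three eigenvalues distinct even if
    \<open>m = 0\<close>; hence the samples 1, -1, 2 below.\<close>
  have r: "sqrt (x\<^sup>2 + m) \<noteq> 0" "(sqrt (x\<^sup>2 + m))\<^sup>2 = x\<^sup>2 + m" if "x \<noteq> 0" for x
    using that m by (simp_all add: add_nonneg_eq_0_iff)
  have e1: "p + q + s = 0" if "x \<noteq> 0" for x :: real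
    using charpoly_coeffs_3(1)[OF ev[of x] r(1)[OF that]]
    by (simp add: herm_def Bii complex_eq_iff)
  have e2: "(x + p) * (q - x) + (x + p) * s + (q - x) * s - A - B' - C = - (x\<^sup>2 + m)"
    if "x \<noteq> 0" for x :: real
    using arg_cong[OF charpoly_coeffs_3(2)[OF ev[of x] r(1)[OF that]], of Re] r(2)[OF that]
    by (simp add: herm_def Bii B21 A_def B'_def C_def cmod_power2 flip: a_def b_def c_def)
      (simp add: algebra_simps power2_eq_square)
  have e3: "(x + p) * (q - x) * s + 2 * T - (x + p) * C - (q - x) * B' - s * A = 0"
    if "x \<noteq> 0" for x :: real
    using arg_cong[OF charpoly_coeffs_3(3)[OF ev[of x] r(1)[OF that]], of Re]
    by (simp add: det_3 herm_def Bii B21 A_def B'_def C_def T_def cmod_power2 flip: a_def b_def c_def)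
      (simp add: algebra_simps power2_eq_square)
  \<comment> \<open>The coefficient of \<open>x\<close> in \<open>e2\<close> is
    \<open>q - p\<close>, that of the square of \<open>x\<close> in \<open>e3\<close> is
    \<open>- s\<close>. Afterwards \<open>e3\<close> reduces to
    \<open>2 * T + x * (B' - C) = 0\<close>.\<close>
  have "p = q" using e2[of 1] e2[of "-1"] by (simp add: algebra_simps)
  moreover have "s = 0" using e3[of 1] e3[of "-1"] e3[of 2] by (simp add: algebra_simps)
  ultimately have d: "p = 0" "q = 0" "s = 0" using e1[of 1] by auto
  have BC: "B' = C" and T0: "T = 0"
    using e3[of 1] e3[of "-1"] d by (simp_all add: algebra_simps)
  show "B = herm 0 (B$1$2) (B$1$3) (B$2$3)"
    by (simp add: vec_eq_iff forall_3 herm_def Bii d B21 flip: a_def b_def c_def)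
  show "(cmod (B$1$2))\<^sup>2 + 2 * (cmod (B$1$3))\<^sup>2 = m"
    using e2[of 1] d BC by (simp add: A_def B'_def C_def flip: a_def b_def c_def)
  show "cmod (B$2$3) = cmod (B$1$3)"
    using BC by (simp add: B'_def C_def flip: b_def c_def)
  show "Re (B$1$2 * B$2$3 * cnj (B$1$3)) = 0"
    using T0 by (simp add: T_def flip: a_def b_def c_def)
qed

section \<open>Reduction to the three normal forms\<close>

lemma cmod_eq_inverse_sqrt_2:
  assumes "2 * (cmod b)\<^sup>2 = 1"
  shows "cmod b = 1 / sqrt 2"
  by (rule power2_eq_imp_eq) (use assms in \<open>simp_all add: power_divide\<close>)

text \<open>The rotation is the identity except in the mixed case. Fixing the third entry of
  \<open>f\<close> to 1 makes its other entries the phases applied to \<open>b\<close> and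
  \<open>c\<close>.\<close>

lemma normal_form:
  fixes a1 a2 b1 b2 c1 c2 :: complex
  assumes nrm: "\<And>z w. (cmod (rlin a1 a2 z w))\<^sup>2 + 2 * (cmod (rlin b1 b2 z w))\<^sup>2 = z\<^sup>2 + w\<^sup>2"
    and bc: "\<And>z w. cmod (rlin c1 c2 z w) = cmod (rlin b1 b2 z w)"
    and re: "\<And>z w. Re (rlin a1 a2 z w * rlin c1 c2 z w * cnj (rlin b1 b2 z w)) = 0"
  obtains k l d :: real and f :: "complex^3" and G
  where "k\<^sup>2 + l\<^sup>2 = 1" "d \<in> {-1, 1}" "\<And>i. cmod (f $ i) = 1"
    "G \<in> {Gamma_JT, Gamma_PJT} \<union> {Gamma_mixed \<alpha> \<gamma> | \<alpha> \<gamma>. \<alpha> \<ge> 0 \<and> \<gamma>\<^sup>2 + 2 * \<alpha>\<^sup>2 = 1}"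
    "\<And>\<sigma> z w. diag_mat f ** herm \<sigma> (rlin a1 a2 (k * z - l * w) (l * z + k * w))
        (rlin b1 b2 (k * z - l * w) (l * z + k * w)) (rlin c1 c2 (k * z - l * w) (l * z + k * w))
        ** ctranspose (diag_mat f) = G \<sigma> z (d * w)"
proof -
  consider (JT) "b1 = 0" "b2 = 0" "c1 = 0" "c2 = 0"
    | (mixed) u where "cmod u = 1" "c1 = u * b1" "c2 = u * b2" "b1 \<noteq> 0 \<or> b2 \<noteq> 0"
    | (PJT) u where "cmod u = 1" "c1 = u * cnj b1" "c2 = u * cnj b2" "Im (b1 * cnj b2) \<noteq> 0"
  proof (rule rlin_eq_modulus[OF bc])
    fix u assume "cmod u = 1" "c1 = u * b1" "c2 = u * b2"
    then show ?thesis
      using that(1) that(2)[of u] by (cases "b1 = 0 \<and> b2 = 0") auto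
  next
    fix u assume "cmod u = 1" "c1 = u * cnj b1" "c2 = u * cnj b2" "Im (b1 * cnj b2) \<noteq> 0"
    then show ?thesis by (rule that(3))
  qed
  then show thesis
  proof cases
    case JT
    have n: "(cmod (rlin a1 a2 z w))\<^sup>2 = z\<^sup>2 + w\<^sup>2" for z w
      using nrm[of z w] JT by (simp add: rlin_def)
    have a1: "cmod a1 = 1" using n[of 1 0] norm_ge_zero[of a1] by (auto simp: rlin_def power2_eq_1_iff)
    have a2: "cmod a2 = 1" using n[of 0 1] norm_ge_zero[of a2] by (auto simp: rlin_def power2_eq_1_iff)
    have "Re (a1 * cnj a2) = 0"
      using n[of 1 1] a1 a2 by (simp add: cmod_rlin_power2)
    moreover have "a2 \<noteq> 0" using a2 by auto
    ultimately obtain v and d :: real where v: "cmod v = 1" "d \<in> {-1, 1}" "v * a1 = of_real (cmod a1)"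
      "v * a2 = \<i> * of_real (d * cmod a2)"
      by (rule orthogonal_phase)
    define f :: "complex^3" where "f = vector [v, 1, 1]"
    have f: "cmod (f $ i) = 1" for i
      using v(1) exhaust_3[of i] by (auto simp: f_def)
    \<comment> \<open>The sign is reversed because the (1,2) entry of \<open>Gamma_JT\<close> is z -
      \<i>\<zeta>, while \<open>orthogonal_phase\<close> yields z + \<i>d\<zeta>.\<close>
    show thesis
    proof (rule that[of 1 0 "-d" f Gamma_JT])
      fix \<sigma> z w :: real
      have "v * rlin a1 a2 z w = rlin 1 (- \<i>) z (- d * w)"
        unfolding rlin_mult v a1 a2 rlin_scale_right by (simp add: mult.commute)
      then show "diag_mat f ** herm \<sigma> (rlin a1 a2 (1 * z - 0 * w) (0 * z + 1 * w))
        (rlin b1 b2 (1 * z - 0 * w) (0 * z + 1 * w)) (rlin c1 c2 (1 * z - 0 * w) (0 * z + 1 * w))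
        ** ctranspose (diag_mat f) = Gamma_JT \<sigma> z (- d * w)"
        unfolding diag_mat_conjugate_herm[OF f] Gamma_eq_herm by (simp add: f_def JT rlin_def)
    qed (use v(2) f in auto)
  next
    case PJT
    have "Re (rlin (u * a1) (u * a2) z w * (cnj (rlin b1 b2 z w))\<^sup>2) = 0" for z w
    proof -
      have "rlin c1 c2 z w = u * cnj (rlin b1 b2 z w)"
        by (simp add: PJT rlin_def algebra_simps)
      then have "rlin (u * a1) (u * a2) z w * (cnj (rlin b1 b2 z w))\<^sup>2 =
          rlin a1 a2 z w * rlin c1 c2 z w * cnj (rlin b1 b2 z w)"
        unfolding rlin_mult[symmetric] by (simp only: power2_eq_square mult_ac)
      then show ?thesis
        by (simp only: re)
    qed
    then have "u * a1 = 0" "u * a2 = 0"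
      using rlin_eq_0_if_cubic_eq_0[OF PJT(4)] by blast+
    then have a: "a1 = 0" "a2 = 0" using PJT(1) by auto
    have n: "2 * (cmod (rlin b1 b2 z w))\<^sup>2 = z\<^sup>2 + w\<^sup>2" for z w
      using nrm[of z w] a by (simp add: rlin_def)
    have b: "cmod b1 = 1 / sqrt 2" "cmod b2 = 1 / sqrt 2"
      using n[of 1 0] n[of 0 1] by (auto intro!: cmod_eq_inverse_sqrt_2 simp: rlin_def)
    have "Re (b1 * cnj b2) = 0"
      using n[of 1 1] b by (simp add: cmod_rlin_power2 power_divide)
    moreover have "b2 \<noteq> 0" using b by auto
    ultimately obtain v and d :: real where v: "cmod v = 1" "d \<in> {-1, 1}" "v * b1 = of_real (cmod b1)"
      "v * b2 = \<i> * of_real (d * cmod b2)"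
      by (rule orthogonal_phase)
    \<comment> \<open>The second phase sends \<open>c = u cnj b\<close> to
      \<open>cnj (v * b)\<close>, so normalising \<open>b\<close> by \<open>v\<close> also
      normalises \<open>c\<close>.\<close>
    define f :: "complex^3" where "f = vector [v, cnj (u * v), 1]"
    have f: "cmod (f $ i) = 1" for i
      using v(1) PJT(1) exhaust_3[of i] by (auto simp: f_def norm_mult)
    show thesis
    proof (rule that[of 1 0 "-d" f Gamma_PJT])
      fix \<sigma> z w :: real
      have B: "v * rlin b1 b2 z w = rlin (of_real (1 / sqrt 2)) (- \<i> * of_real (1 / sqrt 2)) z (- d * w)"
        unfolding rlin_mult v b rlin_scale_right by (simp add: mult.commute)
      have uv: "cnj (u * v) * u = cnj v"
      proof -
        have "cnj (u * v) * u = u * cnj u * cnj v" by (simp only: complex_cnj_mult mult_ac)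
        then show ?thesis by (simp only: mult_cnj_eq_1[OF PJT(1)] mult_1_left)
      qed
      have "cnj (u * v) * rlin c1 c2 z w = (cnj (u * v) * u) * cnj (rlin b1 b2 z w)"
        by (simp add: PJT rlin_def algebra_simps)
      also have "\<dots> = cnj (v * rlin b1 b2 z w)"
        unfolding uv by simp
      also have "\<dots> = rlin (of_real (1 / sqrt 2)) (\<i> * of_real (1 / sqrt 2)) z (- d * w)"
        unfolding B by (simp add: rlin_def)
      finally show "diag_mat f ** herm \<sigma> (rlin a1 a2 (1 * z - 0 * w) (0 * z + 1 * w))
        (rlin b1 b2 (1 * z - 0 * w) (0 * z + 1 * w)) (rlin c1 c2 (1 * z - 0 * w) (0 * z + 1 * w))
        ** ctranspose (diag_mat f) = Gamma_PJT \<sigma> z (- d * w)"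
        unfolding diag_mat_conjugate_herm[OF f] Gamma_eq_herm using B
        by (simp add: f_def a rlin_def[of 0 0])
    qed (use v(2) f in auto)
  next
    case mixed
    define x y where "x = Re (u * a1)" and "y = Re (u * a2)"
    have xy: "z * x + w * y = 0 \<or> rlin b1 b2 z w = 0" for z w
    proof -
      have c: "rlin c1 c2 z w = u * rlin b1 b2 z w"
        by (simp add: mixed rlin_mult)
      have eq: "rlin a1 a2 z w * rlin c1 c2 z w * cnj (rlin b1 b2 z w) =
          u * rlin a1 a2 z w * of_real ((cmod (rlin b1 b2 z w))\<^sup>2)"
        by (simp only: c complex_norm_square mult_ac)
      have "Re (u * rlin a1 a2 z w) * (cmod (rlin b1 b2 z w))\<^sup>2 = 0"
        using re[of z w] unfolding eq times_complex.sel(1)[of _ "of_real _"] by simp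
      moreover have "Re (u * rlin a1 a2 z w) = z * x + w * y"
        unfolding rlin_mult by (simp add: rlin_def x_def y_def)
      ultimately show ?thesis by (metis mult_eq_0_iff norm_eq_zero power_eq_0_iff)
    qed
    \<comment> \<open>The kernel of the nonzero map \<open>b\<close> contains at most one of these
      pairwise independent points, so the linear form \<open>z * x + w * y\<close> vanishes at two
      of them.\<close>
    have "x = 0 \<and> y = 0"
      using mixed(4) xy[of 1 0] xy[of 0 1] xy[of 1 1] by (auto simp: rlin_def)
    define s t where "s = Im (u * a1)" and "t = Im (u * a2)"
    have ua: "u * a1 = \<i> * of_real s" "u * a2 = \<i> * of_real t"
      using \<open>x = 0 \<and> y = 0\<close> by (auto simp: complex_eq_iff x_def y_def s_def t_def)
    \<comment> \<open>The unit vector along \<open>(s, t)\<close>, so that the rotated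
      \<open>a\<close> vanishes on the second axis; if \<open>a = 0\<close> the identity rotation
      serves.\<close>
    obtain k l where kl: "k\<^sup>2 + l\<^sup>2 = 1" "k * t - l * s = 0"
    proof (cases "s = 0 \<and> t = 0")
      case False
      then have "s\<^sup>2 + t\<^sup>2 > 0" by (simp add: sum_power2_gt_zero_iff)
      with False show thesis
        using that[of "s / sqrt (s\<^sup>2 + t\<^sup>2)" "t / sqrt (s\<^sup>2 + t\<^sup>2)"]
        by (simp add: power_divide flip: add_divide_distrib)
    qed (use that[of 1 0] in simp)
    define \<gamma> where "\<gamma> = k * s + l * t"
    define A1 A2 where "A1 = of_real k * a1 + of_real l * a2" and "A2 = of_real k * a2 - of_real l * a1"
    define B1 B2 where "B1 = of_real k * b1 + of_real l * b2" and "B2 = of_real k * b2 - of_real l * b1"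
    have uA1: "u * A1 = \<i> * of_real \<gamma>"
    proof -
      have "u * A1 = of_real k * (u * a1) + of_real l * (u * a2)"
        by (simp add: A1_def algebra_simps)
      then show ?thesis unfolding ua \<gamma>_def by (simp add: algebra_simps)
    qed
    have uA2: "u * A2 = 0"
    proof -
      have "u * A2 = of_real k * (u * a2) - of_real l * (u * a1)"
        by (simp add: A2_def algebra_simps)
      also have "\<dots> = \<i> * of_real (k * t - l * s)" unfolding ua by (simp add: algebra_simps)
      finally show ?thesis by (simp add: kl)
    qed
    have A2: "A2 = 0" using uA2 mixed(1) by auto
    have "cmod (u * A1) = \<bar>\<gamma>\<bar>" unfolding uA1 by (simp add: norm_mult)
    then have A1: "cmod A1 = \<bar>\<gamma>\<bar>" by (simp add: norm_mult mixed(1))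
    have n: "(cmod (rlin A1 A2 z w))\<^sup>2 + 2 * (cmod (rlin B1 B2 z w))\<^sup>2 = z\<^sup>2 + w\<^sup>2" for z w
    proof -
      have "(k * z - l * w)\<^sup>2 + (l * z + k * w)\<^sup>2 = (k\<^sup>2 + l\<^sup>2) * (z\<^sup>2 + w\<^sup>2)"
        by (simp add: power2_eq_square algebra_simps)
      then show ?thesis
        using nrm[of "k * z - l * w" "l * z + k * w"]
        by (simp add: rlin_rotate kl A1_def A2_def B1_def B2_def)
    qed
    \<comment> \<open>The first axis gives the constraint on \<gamma> and \<alpha> =
      \<open>cmod B1\<close>; on the second only \<open>b\<close> contributes, which fixes
      \<open>cmod B2\<close>.\<close>
    have B1: "\<gamma>\<^sup>2 + 2 * (cmod B1)\<^sup>2 = 1" using n[of 1 0] by (simp add: rlin_def A1)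
    have B2: "2 * (cmod B2)\<^sup>2 = 1" using n[of 0 1] by (simp add: rlin_def A2)
    then have B2': "cmod B2 = 1 / sqrt 2" by (rule cmod_eq_inverse_sqrt_2)
    have "Re (B1 * cnj B2) = 0"
      using n[of 1 1] B1 B2 by (simp add: cmod_rlin_power2 A1 A2)
    moreover have "B2 \<noteq> 0" using B2 by auto
    ultimately obtain v and d :: real where v: "cmod v = 1" "d \<in> {-1, 1}" "v * B1 = of_real (cmod B1)"
      "v * B2 = \<i> * of_real (d * cmod B2)"
      by (rule orthogonal_phase)
    \<comment> \<open>The factor \<open>cnj u\<close> makes the entries (1,3) and (2,3) equal, and
      the phase acting on \<open>a\<close> becomes \<open>u\<close>, for which \<open>u * A1\<close>
      is imaginary.\<close>
    define f :: "complex^3" where "f = vector [v, v * cnj u, 1]"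
    have f: "cmod (f $ i) = 1" for i
      using v(1) mixed(1) exhaust_3[of i] by (auto simp: f_def norm_mult)
    have vv: "v * cnj v = 1" by (rule mult_cnj_eq_1) (rule v)
    have uu: "cnj u * u = 1" using mult_cnj_eq_1[OF mixed(1)] by (simp only: mult.commute)
    show thesis
    proof (rule that[of k l d f "Gamma_mixed (cmod B1) \<gamma>"])
      fix \<sigma> z w :: real
      have "v * cnj (v * cnj u) * rlin A1 A2 z w = (v * cnj v) * (u * rlin A1 A2 z w)"
        by (simp add: mult_ac)
      then have a: "v * cnj (v * cnj u) * rlin A1 A2 z w = rlin (\<i> * of_real \<gamma>) 0 z (d * w)"
        unfolding vv rlin_mult uA1 uA2 by (simp add: rlin_def)
      have b: "v * rlin B1 B2 z w = rlin (of_real (cmod B1)) (\<i> * of_real (1 / sqrt 2)) z (d * w)"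
        unfolding rlin_mult v B2' rlin_scale_right by (simp add: mult_ac)
      have "v * cnj u * (u * rlin B1 B2 z w) = (cnj u * u) * (v * rlin B1 B2 z w)"
        by (simp only: mult_ac)
      then have c: "v * cnj u * (u * rlin B1 B2 z w) = v * rlin B1 B2 z w"
        by (simp add: uu)
      have rot: "rlin a1 a2 (k * z - l * w) (l * z + k * w) = rlin A1 A2 z w"
        "rlin b1 b2 (k * z - l * w) (l * z + k * w) = rlin B1 B2 z w"
        "rlin c1 c2 (k * z - l * w) (l * z + k * w) = u * rlin B1 B2 z w"
        unfolding mixed(2,3) rlin_mult[symmetric] unfolding rlin_rotate A1_def A2_def B1_def B2_def
        by (rule refl)+
      show "diag_mat f ** herm \<sigma> (rlin a1 a2 (k * z - l * w) (l * z + k * w))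
        (rlin b1 b2 (k * z - l * w) (l * z + k * w)) (rlin c1 c2 (k * z - l * w) (l * z + k * w))
        ** ctranspose (diag_mat f) = Gamma_mixed (cmod B1) \<gamma> \<sigma> z (d * w)"
        unfolding diag_mat_conjugate_herm[OF f] rot Gamma_eq_herm
        using a b c by (simp add: f_def)
    qed (use v(2) f kl B1 in auto)
  qed
qed

section \<open>Rotations as symplectic maps, and the classification\<close>

lemma linear_symplectic2_rotation:
  assumes "k\<^sup>2 + l\<^sup>2 = 1"
  shows "linear_symplectic2 (\<lambda>p. vector [k * p$1 - l * p$2, l * p$1 + k * p$2])"
proof -
  have "linear (\<lambda>p::real^2. vector [k * p$1 - l * p$2, l * p$1 + k * p$2] :: real^2)"
    by (rule linearI) (simp_all add: vec_eq_iff forall_2 algebra_simps)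
  moreover have "det (matrix (\<lambda>p::real^2. vector [k * p$1 - l * p$2, l * p$1 + k * p$2] :: real^2)) = 1"
    using assms by (simp add: det_2 matrix_def axis_def power2_eq_square)
  ultimately show ?thesis by (simp add: linear_symplectic2_def)
qed

theorem theorem1p2:
  fixes \<Gamma> :: "real^3 \<Rightarrow> complex^3^3"
  assumes "linear \<Gamma>"
    and "\<And>p. self_adjoint_mat (\<Gamma> p)"
    and "\<And>\<sigma> z \<zeta> :: real. eigenvalues (\<Gamma> (vector [\<sigma>, z, \<zeta>])) =
          {complex_of_real (- sqrt (\<sigma>\<^sup>2 + z\<^sup>2 + \<zeta>\<^sup>2)), 0,
           complex_of_real (sqrt (\<sigma>\<^sup>2 + z\<^sup>2 + \<zeta>\<^sup>2))}"
  shows "\<exists>(\<delta>::real) (U :: complex^3^3) (\<kappa> :: real^2 \<Rightarrow> real^2).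
           \<delta> \<in> {-1, 1} \<and> unitary_mat U \<and> linear_symplectic2 \<kappa> \<and>
           (\<exists>G \<in> {Gamma_JT, Gamma_PJT} \<union>
                  {Gamma_mixed \<alpha> \<gamma> | \<alpha> \<gamma>. \<alpha> \<ge> 0 \<and> \<gamma>\<^sup>2 + 2 * \<alpha>\<^sup>2 = 1}.
              \<forall>\<sigma> z \<zeta> :: real.
                U ** \<Gamma> (vector [\<sigma>, \<kappa> (vector [z, \<zeta>]) $ 1, \<kappa> (vector [z, \<zeta>]) $ 2]) ** ctranspose U
                  = G \<sigma> z (\<delta> * \<zeta>))"
proof -
  \<comment> \<open>The eigenvalues at (1,0,0), ordered as on the diagonal of the models at that
    point.\<close>
  define l0 :: "3 \<Rightarrow> real" where "l0 i = vector [1, -1, 0] $ i" for i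
  have l0: "l0 1 = 1" "l0 2 = -1" "l0 3 = 0" by (simp_all add: l0_def)
  have "inj l0"
    unfolding inj_def forall_3 by (simp add: l0)
  moreover have "complex_of_real (l0 i) \<in> eigenvalues (\<Gamma> (vector [1, 0, 0]))" for i
    using exhaust_3[of i] by (auto simp: assms(3) l0)
  ultimately obtain U where U: "unitary_mat U"
    "U ** \<Gamma> (vector [1, 0, 0]) ** ctranspose U = diag_mat (\<chi> i. of_real (l0 i))"
    using unitary_diagonalisation[OF assms(2)] by blast
  define H where "H p = U ** \<Gamma> p ** ctranspose U" for p
  have "linear H"
    by (rule linearI) (simp_all add: H_def linear_add[OF assms(1)] linear_scale[OF assms(1)]
        vec_eq_iff matrix_matrix_mult_def sum.distrib algebra_simps flip: scaleR_sum_right)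
  have H1: "H (vector [1, 0, 0]) = herm 1 0 0 0"
    using U(2) by (simp add: H_def herm_def vec_eq_iff forall_3 diag_mat_def l0)
  \<comment> \<open>By linearity the conjugated family is the fixed diagonal part plus
    \<open>B z w\<close>, which does not depend on \<sigma>.\<close>
  define Z W where "Z = H (vector [0, 1, 0])" and "W = H (vector [0, 0, 1])"
  define B where "B z w = z *\<^sub>R Z + w *\<^sub>R W" for z w
  have H: "H (vector [x, z, w]) = herm x 0 0 0 + B z w" for x z w
  proof -
    have "vector [x, z, w] = x *\<^sub>R vector [1, 0, 0] + z *\<^sub>R vector [0, 1, 0] + w *\<^sub>R (vector [0, 0, 1] :: real^3)"
      by (simp add: vec_eq_iff forall_3)
    then have "H (vector [x, z, w]) = x *\<^sub>R herm 1 0 0 0 + B z w"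
      by (simp add: linear_add[OF \<open>linear H\<close>] linear_scale[OF \<open>linear H\<close>] H1 Z_def W_def B_def)
    moreover have "x *\<^sub>R herm 1 0 0 0 = herm x 0 0 0"
      by (simp add: herm_def vec_eq_iff forall_3 of_real_def)
    ultimately show ?thesis by simp
  qed
  have B_nth: "B z w $ i $ j = rlin (Z $ i $ j) (W $ i $ j) z w" for z w i j
    by (simp add: B_def rlin_def) (simp add: scaleR_conv_of_real)
  have sa: "self_adjoint_mat (B z w)" for z w
  proof -
    have "herm 0 0 0 0 = 0" by (simp add: herm_def vec_eq_iff forall_3)
    then have "B z w = H (vector [0, z, w])" by (simp add: H)
    then show ?thesis by (simp add: H_def self_adjoint_conjugate assms(2))
  qed
  have ev: "{complex_of_real (- sqrt (x\<^sup>2 + (z\<^sup>2 + w\<^sup>2))), 0, complex_of_real (sqrt (x\<^sup>2 + (z\<^sup>2 + w\<^sup>2)))}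
      \<subseteq> eigenvalues (herm x 0 0 0 + B z w)" for x z w
    using eigenvalues_conjugate_subset[OF U(1), of "\<Gamma> (vector [x, z, w])"]
    by (simp only: assms(3) add.assoc flip: H_def H)
  \<comment> \<open>Applied at each fixed \<open>(z, w)\<close> with \<open>m\<close> the sum of
    their squares, \<sigma> being the variable \<open>x\<close>.\<close>
  note spec = spectral_conditions[OF sa sum_power2_ge_zero ev, unfolded B_nth]
  obtain k l d :: real and f :: "complex^3" and G where nf: "k\<^sup>2 + l\<^sup>2 = 1" "d \<in> {-1, 1}"
    "\<And>i. cmod (f $ i) = 1"
    "G \<in> {Gamma_JT, Gamma_PJT} \<union> {Gamma_mixed \<alpha> \<gamma> | \<alpha> \<gamma>. \<alpha> \<ge> 0 \<and> \<gamma>\<^sup>2 + 2 * \<alpha>\<^sup>2 = 1}"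
    "\<And>\<sigma> z w. diag_mat f ** herm \<sigma> (rlin (Z$1$2) (W$1$2) (k * z - l * w) (l * z + k * w))
        (rlin (Z$1$3) (W$1$3) (k * z - l * w) (l * z + k * w))
        (rlin (Z$2$3) (W$2$3) (k * z - l * w) (l * z + k * w))
        ** ctranspose (diag_mat f) = G \<sigma> z (d * w)"
  proof (rule normal_form[OF spec(2) spec(3) spec(4)], goal_cases)
    case 1
    show ?case by (rule 1(1)) (fact 1)+
  qed
  have H_herm: "H (vector [x, z, w]) =
    herm x (rlin (Z$1$2) (W$1$2) z w) (rlin (Z$1$3) (W$1$3) z w) (rlin (Z$2$3) (W$2$3) z w)" for x z w
    by (subst H, subst spec(1)) (simp add: herm_def vec_eq_iff forall_3)
  define \<kappa> :: "real^2 \<Rightarrow> real^2" where "\<kappa> p = vector [k * p$1 - l * p$2, l * p$1 + k * p$2]" for p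
  have eq: "(diag_mat f ** U) ** \<Gamma> (vector [\<sigma>, \<kappa> (vector [z, \<zeta>]) $ 1, \<kappa> (vector [z, \<zeta>]) $ 2])
      ** ctranspose (diag_mat f ** U) = G \<sigma> z (d * \<zeta>)" for \<sigma> z \<zeta>
  proof -
    have "(diag_mat f ** U) ** \<Gamma> p ** ctranspose (diag_mat f ** U) =
        diag_mat f ** H p ** ctranspose (diag_mat f)" for p
      by (simp add: H_def ctranspose_matrix_mult matrix_mul_assoc)
    then show ?thesis
      by (simp add: H_herm \<kappa>_def nf(5))
  qed
  have U': "unitary_mat (diag_mat f ** U)"
    using unitary_mat_mult unitary_diag_mat nf(3) U(1) by blast
  have \<kappa>: "linear_symplectic2 \<kappa>"
    unfolding \<kappa>_def by (rule linear_symplectic2_rotation[OF nf(1)])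
  show ?thesis
    by (intro exI[of _ d] exI[of _ "diag_mat f ** U"] exI[of _ \<kappa>] conjI bexI[of _ G] allI
        nf(2) U' \<kappa> eq nf(4))
qed

end
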